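(* Let $s$ and $n$ be positive integers with $n > 2s^2 + 3s + 1$, and let $\beta$ be an ordinal. Then the graph $G(\beta, t^n_s)$ has no odd cycles of length $2s+1$ or shorter.
   Context: Natural numbers are identified with the set of their predecessors, $k = \{0, \ldots, k-1\}$. All graphs are simple and undirected. For an ordinal $\beta$ and a positive integer $n$, $[\beta]^n$ is the set of $n$-element subsets of $\beta$, and $[\mathrm{Ord}]^n$ is the class of $n$-element sets of ordinals. A disjoint type of width $n$ is a function $t : 2n \to 2$ with $|t^{-1}(0)| = |t^{-1}(1)| = n$. If $a, b \in [\mathrm{Ord}]^n$ are disjoint and $a \cup b$ is enumerated in increasing order as $\{\alpha_i \mid i < 2n\}$, then the type of $a$ and $b$ is $t$, written $\mathrm{tp}(a,b) = t$, if $a = \{\alpha_i \mid i \in t^{-1}(0)\}$ and $b = \{\alpha_i \mid i \in t^{-1}(1)\}$. The type $\hat{t}$ is defined by $\hat{t}(i) = 1 - t(i)$ for all $i < 2n$. For $1 \leq s < n < \omega$, $t^n_s$ is the disjoint type of width $n$ whose binary string representation consists of $s$ copies of '0', followed by $n-s$ copies of '01', followed by $s$ copies of '1'. That is, for $i < 2n$: $t^n_s(i) = 0$ if $i < s$; $t^n_s(i) = 0$ if $s \leq i < 2n - s$ and $i - s$ is even; $t^n_s(i) = 1$ if $s \leq i < 2n - s$ and $i - s$ is odd; $t^n_s(i) = 1$ if $i \geq 2n - s$. For example, $t^5_2 = 0001010111$. For an ordinal $\beta$ and a disjoint type $t$ of width $n$, the graph $G(\beta, t)$ has vertex set $[\beta]^n$,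 and for $a, b \in [\beta]^n$, $\{a,b\}$ is an edge if and only if $a$ and $b$ are disjoint and $\mathrm{tp}(a,b) \in \{t, \hat{t}\}$. *)

theory Defs
  imports Main "HOL-Library.Ramsey"
begin

type_synonym 'v ugraph = "'v set \<times> 'v set set"

text \<open>
  A cycle is given by the cyclic list of its (pairwise distinct) vertices, so that the length of
  the list is the length of the cycle.
\<close>

definition is_cycle :: "'v ugraph \<Rightarrow> 'v list \<Rightarrow> bool" where
  "is_cycle G p \<longleftrightarrow>
     3 \<le> length p \<and> distinct p \<and> set p \<subseteq> fst G \<and>
     (\<forall>i < length p. {p ! i, p ! (Suc i mod length p)} \<in> snd G)"

text \<open>
  A function from \<open>2n\<close> to \<open>2\<close> is represented by a function on all natural numbers; only its
  values below \<open>2n\<close> are ever inspected.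
\<close>

definition disjoint_type :: "nat \<Rightarrow> (nat \<Rightarrow> nat) \<Rightarrow> bool" where
  "disjoint_type n t \<longleftrightarrow>
     t ` {..<2 * n} \<subseteq> {0, 1} \<and>
     card {i. i < 2 * n \<and> t i = 0} = n \<and> card {i. i < 2 * n \<and> t i = 1} = n"

definition dual_type :: "(nat \<Rightarrow> nat) \<Rightarrow> (nat \<Rightarrow> nat)" where
  "dual_type t = (\<lambda>i. 1 - t i)"

definition std_type :: "nat \<Rightarrow> nat \<Rightarrow> (nat \<Rightarrow> nat)" where
  "std_type n s = (\<lambda>i.
     if i < s then 0
     else if i < 2 * n - s then (if even (i - s) then 0 else 1)
     else 1)"

lemma std_type_5_2: "map (std_type 5 2) [0..<10] = [0, 0, 0, 1, 0, 1, 0, 1, 1, 1]"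
  by (simp add: std_type_def upt_rec)

lemma disjoint_type_std_type:
  assumes "1 \<le> s" "s < n"
  shows "disjoint_type n (std_type n s)"
proof -
  have zeros: "{i. i < 2 * n \<and> std_type n s i = 0} = {..<s} \<union> (\<lambda>j. s + 2 * j) ` {..<n - s}"
    (is "?Z = ?A \<union> ?B")
  proof (intro set_eqI iffI)
    fix i assume i: "i \<in> ?Z"
    show "i \<in> ?A \<union> ?B"
    proof (cases "i < s")
      case False
      with i have "even (i - s)" "i < 2 * n - s"
        by (auto simp: std_type_def split: if_splits)
      then obtain j where "i - s = 2 * j" by (elim evenE)
      with False \<open>i < 2 * n - s\<close> have "i = s + 2 * j" "j < n - s" by auto
      then show ?thesis by blast
    qed simp
  qed (use assms in \<open>auto simp: std_type_def\<close>)
  have card_zeros: "card ?Z = n"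
  proof -
    have "card ?B = n - s" by (subst card_image) (auto simp: inj_on_def)
    then have "card (?A \<union> ?B) = s + (n - s)" by (subst card_Un_disjoint) auto
    with zeros assms show ?thesis by simp
  qed
  have "{i. i < 2 * n \<and> std_type n s i = 1} = {..<2 * n} - ?Z"
    by (auto simp: std_type_def)
  then have "card {i. i < 2 * n \<and> std_type n s i = 1} = 2 * n - card ?Z"
    by (simp add: card_Diff_subset subset_iff)
  with card_zeros show ?thesis
    by (auto simp: disjoint_type_def std_type_def)
qed

text \<open>
  Ordinals are represented by well-order relations in the reflexive sense of \<^const>\<open>Well_order\<close>;
  the elements of the ordinal \<open>\<beta>\<close> are the members of \<open>Field \<beta>\<close>, and their strict order
  is \<open>\<beta> - Id\<close>.
\<close>

definition increasing_enum :: "'a rel \<Rightarrow> nat \<Rightarrow> (nat \<Rightarrow> 'a) \<Rightarrow> 'a set \<Rightarrow> bool" where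
  "increasing_enum \<beta> m \<alpha> X \<longleftrightarrow>
     \<alpha> ` {..<m} = X \<and> monotone_on {..<m} (<) (\<lambda>x y. (x, y) \<in> \<beta> - Id) \<alpha>"

definition has_type :: "'a rel \<Rightarrow> nat \<Rightarrow> 'a set \<Rightarrow> 'a set \<Rightarrow> (nat \<Rightarrow> nat) \<Rightarrow> bool" where
  "has_type \<beta> n a b t \<longleftrightarrow>
     (\<exists>\<alpha>. increasing_enum \<beta> (2 * n) \<alpha> (a \<union> b) \<and>
        a = \<alpha> ` {i. i < 2 * n \<and> t i = 0} \<and> b = \<alpha> ` {i. i < 2 * n \<and> t i = 1})"

text \<open>The width \<open>n\<close> of the type \<open>t\<close> is passed explicitly.\<close>

definition type_graph :: "'a rel \<Rightarrow> nat \<Rightarrow> (nat \<Rightarrow> nat) \<Rightarrow> 'a set ugraph" where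
  "type_graph \<beta> n t =
     ([Field \<beta>]\<^bsup>n\<^esup>,
      {{a, b} | a b. a \<in> [Field \<beta>]\<^bsup>n\<^esup> \<and> b \<in> [Field \<beta>]\<^bsup>n\<^esup> \<and> a \<inter> b = {} \<and>
         (has_type \<beta> n a b t \<or> has_type \<beta> n a b (dual_type t))})"

end

theory Submission
  imports Defs
begin

text \<open>
  Let \<open>a\<close> and \<open>b\<close> have type \<open>std_type n s\<close>. Writing both sets increasingly, the
  middle block \<open>0101...01\<close> of the type says \<open>a\<^sub>k < b\<^bsub>k-s\<^esub>\<close> whenever
  \<open>s \<le> k\<close>, and \<open>b\<^sub>k < a\<^bsub>k+s+1\<^esub>\<close> whenever \<open>k + s + 1 < n\<close>
  (lemmas \<open>has_type_forward\<close> and \<open>has_type_backward\<close>). So every edge can be followed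
  upwards in the ordinal, at the price of lowering the index by \<open>s\<close> if the edge is traversed
  from \<open>a\<close> to \<open>b\<close>, and raising it by \<open>s + 1\<close> if it is traversed from \<open>b\<close> to \<open>a\<close>.

  Follow a closed walk of odd length \<open>L \<le> 2s + 1\<close>. Its numbers of forward and of backward
  edges differ, so after reversing it if necessary the number \<open>g\<close> of backward edges satisfies
  \<open>2g < L\<close>. The total change of the index is then \<open>-sL + (2s + 1)g\<close>, which is at most \<open>0\<close>.
  Hence the walk leads from an element of the first vertex to a strictly larger element of the
  same vertex whose index is not larger, which is absurd.

  The bound on \<open>n\<close> keeps the index within \<open>{0..<n}\<close>: it moves by at most \<open>s + 1\<close> at each
  of at most \<open>2s + 1\<close> steps, so all the values it takes lie within a window of
  length \<open>(2s + 1)(s + 1) = 2s\<^sup>2 + 3s + 1 < n\<close>, and a suitable starting index puts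
  that window inside \<open>{0..<n}\<close>.
\<close>

section \<open>Ranks in a finite set of ordinals\<close>

text \<open>
  The rank is the index of an element in the increasing enumeration of \<open>a\<close>, starting from \<open>0\<close>.
  Being defined without an enumeration, it allows the different edges at one vertex, each of
  which brings its own enumeration, to be compared.
\<close>

definition rank :: "'a rel \<Rightarrow> 'a set \<Rightarrow> 'a \<Rightarrow> nat" where
  "rank \<beta> a x = card {y \<in> a. (y, x) \<in> \<beta> - Id}"

lemma rank_strict_mono:
  assumes "Well_order \<beta>" "finite a" "x \<in> a" "(x, y) \<in> \<beta> - Id"
  shows "rank \<beta> a x < rank \<beta> a y"
proof -
  have "trans \<beta>" "antisym \<beta>"
    using assms(1) by (auto simp: order_on_defs)
  then have "{z \<in> a. (z, x) \<in> \<beta> - Id} \<subset> {z \<in> a. (z, y) \<in> \<beta> - Id}"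
    using assms(3,4) by (auto dest: transD antisymD)
  then show ?thesis
    unfolding rank_def using assms(2) by (intro psubset_card_mono) auto
qed

lemma ex_rank:
  assumes wo: "Well_order \<beta>" and a: "a \<in> [Field \<beta>]\<^bsup>n\<^esup>" and "k < n"
  shows "\<exists>x\<in>a. rank \<beta> a x = k"
proof -
  have fin: "finite a" and card: "card a = n" and sub: "a \<subseteq> Field \<beta>"
    using a by (auto simp: nsets_def)
  have inj: "inj_on (rank \<beta> a) a"
  proof (rule inj_onI, rule ccontr)
    fix x y assume xy: "x \<in> a" "y \<in> a" "rank \<beta> a x = rank \<beta> a y" "x \<noteq> y"
    have "total_on (Field \<beta>) \<beta>"
      using wo by (auto simp: order_on_defs)
    then have "(x, y) \<in> \<beta> - Id \<or> (y, x) \<in> \<beta> - Id"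
      using xy sub by (auto simp: total_on_def)
    then show False
      using rank_strict_mono[OF wo fin] xy by fastforce
  qed
  have "rank \<beta> a x < n" if "x \<in> a" for x
    unfolding rank_def card[symmetric] using that fin by (intro psubset_card_mono) auto
  then have "rank \<beta> a ` a = {..<n}"
    using card_image[OF inj] card by (intro card_subset_eq) auto
  then show ?thesis
    using \<open>k < n\<close> by (metis imageE lessThan_iff)
qed

text \<open>
  This reduces ranks in either of two sets of type \<open>t\<close> to counting letters of \<open>t\<close>: take \<open>v = 0\<close>
  for the first set and \<open>v = 1\<close> for the second.
\<close>

lemma rank_increasing_enum:
  assumes "Well_order \<beta>" and inc: "increasing_enum \<beta> m \<alpha> X"
    and "a = \<alpha> ` {i. i < m \<and> t i = v}" and "i < m"
  shows "rank \<beta> a (\<alpha> i) = card {j. j < i \<and> t j = v}"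
proof -
  have "antisym \<beta>"
    using assms(1) by (auto simp: order_on_defs)
  have less: "(\<alpha> j, \<alpha> k) \<in> \<beta> - Id" if "j < k" "k < m" for j k
    using inc that by (auto simp: increasing_enum_def monotone_on_def)
  have iff: "(\<alpha> j, \<alpha> i) \<in> \<beta> - Id \<longleftrightarrow> j < i" if "j < m" for j
  proof (cases j i rule: linorder_cases)
    case greater
    then have "(\<alpha> i, \<alpha> j) \<in> \<beta> - Id"
      using less that by blast
    with greater show ?thesis
      using \<open>antisym \<beta>\<close> by (auto dest: antisymD)
  qed (use less \<open>i < m\<close> in auto)
  have "inj_on \<alpha> {..<m}"
  proof (rule inj_onI, rule ccontr)
    fix j k assume jk: "j \<in> {..<m}" "k \<in> {..<m}" "\<alpha> j = \<alpha> k" "j \<noteq> k"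
    then show False
      using less[of j k] less[of k j] by (cases j k rule: linorder_cases) simp_all
  qed
  then have "inj_on \<alpha> {j. j < i \<and> t j = v}"
    by (rule inj_on_subset) (use \<open>i < m\<close> in auto)
  moreover have "{y \<in> a. (y, \<alpha> i) \<in> \<beta> - Id} = \<alpha> ` {j. j < i \<and> t j = v}"
  proof -
    have "{y \<in> a. (y, \<alpha> i) \<in> \<beta> - Id} = \<alpha> ` {j. j < m \<and> t j = v \<and> (\<alpha> j, \<alpha> i) \<in> \<beta> - Id}"
      unfolding assms(3) by (simp only: Compr_image_eq mem_Collect_eq conj_assoc)
    also have "{j. j < m \<and> t j = v \<and> (\<alpha> j, \<alpha> i) \<in> \<beta> - Id} = {j. j < i \<and> t j = v}"
      using iff \<open>i < m\<close> less_trans[of _ i m] by blast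
    finally show ?thesis .
  qed
  ultimately show ?thesis
    by (simp add: rank_def card_image)
qed

section \<open>Following an edge upwards\<close>

lemma card_less_Suc_eq:
  "card {j. j < Suc i \<and> P j} = card {j. j < i \<and> P j} + (if P i then 1 else 0)"
proof (cases "P i")
  case True
  then have "{j. j < Suc i \<and> P j} = insert i {j. j < i \<and> P j}"
    by (auto simp: less_Suc_eq)
  then show ?thesis
    using True by (simp only: if_True) (subst card_insert_disjoint, auto)
next
  case False
  then have "{j. j < Suc i \<and> P j} = {j. j < i \<and> P j}"
    by (auto simp: less_Suc_eq)
  then show ?thesis
    using False by (simp only: if_False)
qed

lemma card_std_type_eq_0:
  "s \<le> i \<Longrightarrow> i \<le> 2 * n - s \<Longrightarrow>
    card {j. j < i \<and> std_type n s j = 0} = s + (i - s + 1) div 2"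
proof (induction i rule: dec_induct)
  case base
  have "{j. j < s \<and> std_type n s j = 0} = {..<s}"
    by (auto simp: std_type_def)
  then show ?case by simp
next
  case (step i)
  then show ?case
    by (auto simp: card_less_Suc_eq std_type_def Suc_diff_le elim!: evenE oddE)
qed

lemma card_std_type_eq_1:
  "s \<le> i \<Longrightarrow> i \<le> 2 * n - s \<Longrightarrow>
    card {j. j < i \<and> std_type n s j = 1} = (i - s) div 2"
proof (induction i rule: dec_induct)
  case base
  have "{j. j < s \<and> std_type n s j = 1} = {}"
    by (auto simp: std_type_def)
  then show ?case by simp
next
  case (step i)
  then show ?case
    by (auto simp: card_less_Suc_eq std_type_def Suc_diff_le elim!: evenE oddE)
qed

text \<open>
  A letter \<open>0\<close> with at least \<open>s\<close> zeros before it lies in the middle block, so that the next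
  letter is \<open>1\<close>.
\<close>

lemma has_type_forward:
  assumes wo: "Well_order \<beta>"
    and ab: "has_type \<beta> n a b (std_type n s)" and "x \<in> a" and "s \<le> rank \<beta> a x"
  shows "\<exists>y\<in>b. rank \<beta> b y = rank \<beta> a x - s \<and> (x, y) \<in> \<beta> - Id"
proof -
  let ?t = "std_type n s"
  obtain \<alpha> where inc: "increasing_enum \<beta> (2 * n) \<alpha> (a \<union> b)"
    and a: "a = \<alpha> ` {i. i < 2 * n \<and> ?t i = 0}" and b: "b = \<alpha> ` {i. i < 2 * n \<and> ?t i = 1}"
    using ab by (auto simp: has_type_def)
  obtain i where i: "i < 2 * n" "?t i = 0" "x = \<alpha> i"
    using \<open>x \<in> a\<close> a by auto
  have rank: "rank \<beta> a x = card {j. j < i \<and> ?t j = 0}"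
    using rank_increasing_enum[OF wo inc a] i by simp
  have "s \<le> i"
  proof -
    have "card {j. j < i \<and> ?t j = 0} \<le> card {..<i}"
      by (rule card_mono) auto
    then show ?thesis
      using rank \<open>s \<le> rank \<beta> a x\<close> by simp
  qed
  with i have i': "i < 2 * n - s" "even (i - s)"
    by (auto simp: std_type_def split: if_splits)
  \<comment> \<open>The block has even length and \<open>i\<close> an even offset in it, so \<open>i\<close> is not its last position.\<close>
  then have "Suc i < 2 * n - s"
    using \<open>s \<le> i\<close> by presburger
  then have Suc_i: "Suc i < 2 * n - s" "?t (Suc i) = 1"
    using \<open>s \<le> i\<close> i'(2) by (auto simp: std_type_def Suc_diff_le)
  have "rank \<beta> b (\<alpha> (Suc i)) = card {j. j < Suc i \<and> ?t j = 1}"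
    using rank_increasing_enum[OF wo inc b] Suc_i by simp
  also have "\<dots> = (Suc i - s) div 2"
    using \<open>s \<le> i\<close> Suc_i by (intro card_std_type_eq_1) auto
  also have "\<dots> = (i - s + 1) div 2"
    using \<open>s \<le> i\<close> by (simp only: Suc_diff_le Suc_eq_plus1)
  also have "\<dots> = rank \<beta> a x - s"
    unfolding rank using \<open>s \<le> i\<close> i'(1) card_std_type_eq_0[of s i n] by simp
  finally have "rank \<beta> b (\<alpha> (Suc i)) = rank \<beta> a x - s" .
  moreover have "(x, \<alpha> (Suc i)) \<in> \<beta> - Id"
    using inc i Suc_i by (auto simp: increasing_enum_def monotone_on_def)
  moreover have "\<alpha> (Suc i) \<in> b"
    using b Suc_i by auto
  ultimately show ?thesis by blast
qed

text \<open>
  A letter \<open>1\<close> with fewer than \<open>n - s - 1\<close> ones before it lies in the middle block and is not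
  the last letter of that block, so that the next letter is \<open>0\<close>.
\<close>

lemma has_type_backward:
  assumes wo: "Well_order \<beta>"
    and ab: "has_type \<beta> n a b (std_type n s)" and "y \<in> b" and less: "rank \<beta> b y + s + 1 < n"
  shows "\<exists>x\<in>a. rank \<beta> a x = rank \<beta> b y + s + 1 \<and> (y, x) \<in> \<beta> - Id"
proof -
  let ?t = "std_type n s"
  obtain \<alpha> where inc: "increasing_enum \<beta> (2 * n) \<alpha> (a \<union> b)"
    and a: "a = \<alpha> ` {i. i < 2 * n \<and> ?t i = 0}" and b: "b = \<alpha> ` {i. i < 2 * n \<and> ?t i = 1}"
    using ab by (auto simp: has_type_def)
  obtain i where i: "i < 2 * n" "?t i = 1" "y = \<alpha> i"
    using \<open>y \<in> b\<close> b by auto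
  have rank: "rank \<beta> b y = card {j. j < i \<and> ?t j = 1}"
    using rank_increasing_enum[OF wo inc b] i by simp
  have "i < 2 * n - s"
  proof (rule ccontr)
    assume "\<not> i < 2 * n - s"
    then have "card {j. j < 2 * n - s \<and> ?t j = 1} \<le> card {j. j < i \<and> ?t j = 1}"
      by (intro card_mono) auto
    then show False
      using rank less card_std_type_eq_1[of s "2 * n - s" n] by simp
  qed
  with i have i': "s \<le> i" "odd (i - s)"
    by (auto simp: std_type_def split: if_splits)
  have "rank \<beta> b y = (i - s) div 2"
    using i'(1) \<open>i < 2 * n - s\<close> rank card_std_type_eq_1[of s i n] by simp
  then have rank': "2 * rank \<beta> b y + 1 = i - s"
    using odd_two_times_div_two_succ[OF i'(2)] by (simp only:)
  then have Suc_i: "Suc i < 2 * n - s"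
    using less i'(1) by linarith
  then have "?t (Suc i) = 0"
    using i' by (simp add: std_type_def Suc_diff_le)
  have "rank \<beta> a (\<alpha> (Suc i)) = card {j. j < Suc i \<and> ?t j = 0}"
    using rank_increasing_enum[OF wo inc a] Suc_i by simp
  also have "\<dots> = s + (Suc i - s + 1) div 2"
    using i'(1) Suc_i by (intro card_std_type_eq_0) auto
  also have "\<dots> = rank \<beta> b y + s + 1"
    using i'(1) rank' by linarith
  finally have "rank \<beta> a (\<alpha> (Suc i)) = rank \<beta> b y + s + 1" .
  moreover have "(y, \<alpha> (Suc i)) \<in> \<beta> - Id"
    using inc i Suc_i by (auto simp: increasing_enum_def monotone_on_def)
  moreover have "\<alpha> (Suc i) \<in> a"
    using a Suc_i \<open>?t (Suc i) = 0\<close> by auto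
  ultimately show ?thesis by blast
qed

lemma has_type_dual_std_type:
  assumes "has_type \<beta> n a b (dual_type (std_type n s))"
  shows "has_type \<beta> n b a (std_type n s)"
proof -
  have "dual_type (std_type n s) i = 0 \<longleftrightarrow> std_type n s i = 1"
    "dual_type (std_type n s) i = 1 \<longleftrightarrow> std_type n s i = 0" for i
    by (auto simp: dual_type_def std_type_def)
  with assms show ?thesis
    by (auto simp: has_type_def Un_commute)
qed

lemma type_graph_edge:
  assumes "{a, b} \<in> snd (type_graph \<beta> n (std_type n s))"
  shows "has_type \<beta> n a b (std_type n s) \<or> has_type \<beta> n b a (std_type n s)"
  using assms by (auto simp: type_graph_def doubleton_eq_iff dest: has_type_dual_std_type)

section \<open>Closed walks\<close>

text \<open>
  This bounds the width of the window in which the index stays; both orders of \<open>i\<close> and \<open>j\<close> matter because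
  the lowest point of the walk may come before or after the highest one.
\<close>

lemma sum_diff_le:
  fixes d :: "nat \<Rightarrow> int"
  assumes d: "\<And>i. i < L \<Longrightarrow> \<bar>d i\<bar> \<le> M" and "i \<le> L" "j \<le> L"
  shows "sum d {..<i} - sum d {..<j} \<le> int L * M"
proof -
  have *: "\<bar>sum d {..<v} - sum d {..<u}\<bar> \<le> int L * M" if "u \<le> v" "v \<le> L" for u v
  proof (cases "L = 0")
    case False
    then have "0 \<le> M"
      using d[of 0] by auto
    have "sum d {..<v} - sum d {..<u} = sum d {u..<v}"
      using sum_diff_nat_ivl[of 0 u v d] that by (simp add: atLeast0LessThan)
    also have "\<bar>\<dots>\<bar> \<le> (\<Sum>i\<in>{u..<v}. M)"
      using d that by (intro order_trans[OF sum_abs] sum_mono) auto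
    also have "\<dots> \<le> int L * M"
      using that \<open>0 \<le> M\<close> by (auto intro!: mult_right_mono)
    finally show ?thesis .
  qed (use that in auto)
  show ?thesis
    using *[of i j] *[of j i] assms(2,3) by (cases "i \<le> j") auto
qed

text \<open>
  The walk is given with an orientation: \<open>B i\<close> says that its \<open>i\<close>-th edge is traversed backwards.
  The integers \<open>h i\<close> in the proof record the change of the index during the first \<open>i\<close> steps;
  starting at index \<open>- m\<close>, where \<open>m\<close> is the least of them, the index never becomes negative.
\<close>

lemma no_closed_walk_few_backward:
  fixes c :: "nat \<Rightarrow> 'a set"
  assumes wo: "Well_order \<beta>" and n: "(2 * s + 1) * (s + 1) < n"
    and L: "L \<le> 2 * s + 1" and closed: "c L = c 0" and c0: "c 0 \<in> [Field \<beta>]\<^bsup>n\<^esup>"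
    and backward: "\<And>i. i < L \<Longrightarrow> B i \<Longrightarrow> has_type \<beta> n (c (Suc i)) (c i) (std_type n s)"
    and forward: "\<And>i. i < L \<Longrightarrow> \<not> B i \<Longrightarrow> has_type \<beta> n (c i) (c (Suc i)) (std_type n s)"
    and few: "2 * card {i. i < L \<and> B i} < L"
  shows False
proof -
  define d where "d i = (if B i then int s + 1 else - int s)" for i
  define h where "h i = sum d {..<i}" for i
  define m where "m = Min (h ` {..L})"
  have m_le: "m \<le> h i" if "i \<le> L" for i
    unfolding m_def using that by (intro Min_le) auto
  have "m \<in> h ` {..L}"
    unfolding m_def by (intro Min_in) auto
  then obtain j where j: "j \<le> L" "m = h j" by auto
  have less_n: "h i - m < int n" if "i \<le> L" for i
  proof -
    have "h i - m \<le> int L * (int s + 1)"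
      unfolding j(2) h_def using that j(1) by (intro sum_diff_le) (auto simp: d_def)
    also have "\<dots> \<le> int ((2 * s + 1) * (s + 1))"
      using L by (simp only: of_nat_mult) (intro mult_mono, auto)
    finally show ?thesis using n by linarith
  qed
  have h_Suc: "h (Suc i) = h i + d i" for i
    by (simp add: h_def)
  have "h 0 = 0" by (simp add: h_def)
  then have "nat (- m) < n"
    using less_n[of 0] n by auto
  then obtain x where x: "x \<in> c 0" "rank \<beta> (c 0) x = nat (- m)"
    using ex_rank[OF wo c0] by blast
  have "trans \<beta>" "antisym \<beta>"
    using wo by (auto simp: order_on_defs)
  then have trans_less: "(u, w) \<in> \<beta> - Id" if "(u, v) \<in> \<beta> - Id" "(v, w) \<in> \<beta> - Id" for u v w
    using that by (auto dest: transD antisymD)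
  have "\<exists>y\<in>c i. rank \<beta> (c i) y = nat (h i - m) \<and> (i = 0 \<and> y = x \<or> (x, y) \<in> \<beta> - Id)"
    if "i \<le> L" for i
    using that
  proof (induction i)
    case 0
    then show ?case using x \<open>h 0 = 0\<close> by auto
  next
    case (Suc i)
    then obtain y where y: "y \<in> c i" "rank \<beta> (c i) y = nat (h i - m)"
      "y = x \<or> (x, y) \<in> \<beta> - Id" by auto
    have "\<exists>z\<in>c (Suc i). rank \<beta> (c (Suc i)) z = nat (h (Suc i) - m) \<and> (y, z) \<in> \<beta> - Id"
    proof (cases "B i")
      case True
      have "rank \<beta> (c i) y + s + 1 = nat (h (Suc i) - m)"
        using y(2) True m_le[of i] Suc.prems by (simp add: h_Suc d_def)
      moreover have "nat (h (Suc i) - m) < n"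
        using less_n[of "Suc i"] Suc.prems n by auto
      ultimately show ?thesis
        using has_type_backward[OF wo backward y(1)] True Suc.prems by (metis Suc_le_eq)
    next
      case False
      have "s \<le> rank \<beta> (c i) y" "rank \<beta> (c i) y - s = nat (h (Suc i) - m)"
        using y(2) False m_le[of "Suc i"] Suc.prems by (auto simp: h_Suc d_def)
      then show ?thesis
        using has_type_forward[OF wo forward y(1)] False Suc.prems by (metis Suc_le_eq)
    qed
    then show ?case
      using y(3) trans_less by blast
  qed
  from this[of L] obtain y where y: "y \<in> c 0" "rank \<beta> (c 0) y = nat (h L - m)"
    "(x, y) \<in> \<beta> - Id"
    using few closed by auto
  \<comment> \<open>As \<open>2g \<le> L - 1\<close>, the total change \<open>-sL + (2s + 1)g\<close> is at most \<open>(L - (2s + 1))/2\<close>.\<close>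
  have "h L \<le> 0"
  proof -
    define g where "g = card {i. i < L \<and> B i}"
    have "h L = (\<Sum>i<L. - int s + (if B i then 2 * int s + 1 else 0))"
      unfolding h_def d_def by (intro sum.cong) auto
    also have "\<dots> = - (int s * int L) + (2 * int s + 1) * int g"
      by (simp add: sum.distrib sum_subtractf sum.If_cases g_def Int_def)
    finally have "2 * h L = (2 * int s + 1) * (2 * int g) - 2 * int s * int L"
      by (simp add: algebra_simps)
    also have "\<dots> \<le> (2 * int s + 1) * (int L - 1) - 2 * int s * int L"
      using few by (intro diff_right_mono mult_left_mono) (auto simp: g_def)
    also have "\<dots> \<le> 0"
      using L by (simp add: algebra_simps)
    finally show ?thesis by simp
  qed
  then have "rank \<beta> (c 0) y \<le> rank \<beta> (c 0) x"
    using x(2) y(2) by simp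
  moreover have "rank \<beta> (c 0) x < rank \<beta> (c 0) y"
    using c0 x(1) y(3) by (intro rank_strict_mono[OF wo]) (auto simp: nsets_def)
  ultimately show False by simp
qed

text \<open>Reversing a walk exchanges forward and backward edges.\<close>

lemma no_odd_closed_walk:
  fixes c :: "nat \<Rightarrow> 'a set"
  assumes wo: "Well_order \<beta>" and n: "(2 * s + 1) * (s + 1) < n"
    and L: "L \<le> 2 * s + 1" "odd L" and closed: "c L = c 0" and c0: "c 0 \<in> [Field \<beta>]\<^bsup>n\<^esup>"
    and edge: "\<And>i. i < L \<Longrightarrow> has_type \<beta> n (c i) (c (Suc i)) (std_type n s)
                          \<or> has_type \<beta> n (c (Suc i)) (c i) (std_type n s)"
  shows False
proof -
  define B where "B i \<longleftrightarrow> \<not> has_type \<beta> n (c i) (c (Suc i)) (std_type n s)" for i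
  define g where "g = card {i. i < L \<and> B i}"
  consider "2 * g < L" | "L < 2 * g"
    using \<open>odd L\<close> by (metis dvd_triv_left linorder_neqE_nat)
  then show False
  proof cases
    case 1
    show False
      by (rule no_closed_walk_few_backward[OF wo n L(1) closed c0, where B = B])
        (use 1 edge in \<open>auto simp: B_def g_def\<close>)
  next
    case 2
    define c' where "c' i = c (L - i)" for i
    define B' where "B' i \<longleftrightarrow> \<not> B (L - Suc i)" for i
    have B': "2 * card {i. i < L \<and> B' i} < L"
    proof -
      have "bij_betw (\<lambda>i. L - Suc i) {i. i < L \<and> B' i} ({..<L} - {i. i < L \<and> B i})"
        by (rule bij_betw_byWitness[where f' = "\<lambda>i. L - Suc i"]) (auto simp: B'_def)
      then have "card {i. i < L \<and> B' i} = card ({..<L} - {i. i < L \<and> B i})"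
        by (rule bij_betw_same_card)
      also have "\<dots> = L - g"
        unfolding g_def by (subst card_Diff_subset) auto
      finally show ?thesis using 2 odd_pos[OF \<open>odd L\<close>] by linarith
    qed
    have c'_eq: "c' i = c (Suc (L - Suc i))" "c' (Suc i) = c (L - Suc i)" if "i < L" for i
      using that by (simp_all add: c'_def Suc_diff_Suc)
    show False
    proof (rule no_closed_walk_few_backward[OF wo n L(1), where B = B' and c = c'])
      show "c' L = c' 0" "c' 0 \<in> [Field \<beta>]\<^bsup>n\<^esup>"
        using closed c0 by (simp_all add: c'_def)
      show "has_type \<beta> n (c' (Suc i)) (c' i) (std_type n s)" if "i < L" "B' i" for i
        using that by (simp add: c'_eq B'_def B_def)
      show "has_type \<beta> n (c' i) (c' (Suc i)) (std_type n s)" if "i < L" "\<not> B' i" for i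
        using that edge[of "L - Suc i"] by (simp add: c'_eq B'_def B_def)
    qed (rule B')
  qed
qed

theorem theorem5:
  fixes s n :: nat and \<beta> :: "'a rel"
  assumes "0 < s" and "0 < n"
    and "n > 2 * s ^ 2 + 3 * s + 1"
    and "Well_order \<beta>"
  shows "\<not> (\<exists>p. is_cycle (type_graph \<beta> n (std_type n s)) p \<and>
               odd (length p) \<and> length p \<le> 2 * s + 1)"
proof
  assume "\<exists>p. is_cycle (type_graph \<beta> n (std_type n s)) p \<and> odd (length p) \<and> length p \<le> 2 * s + 1"
  then obtain p where p: "is_cycle (type_graph \<beta> n (std_type n s)) p"
    and len: "odd (length p)" "length p \<le> 2 * s + 1" by blast
  define c where "c i = p ! (i mod length p)" for i
  have "0 < length p"
    using len(1) by (rule odd_pos)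
  show False
  proof (rule no_odd_closed_walk[OF assms(4), where c = c and L = "length p"])
    show "(2 * s + 1) * (s + 1) < n"
      using assms(3) by (simp add: algebra_simps power2_eq_square)
    show "c (length p) = c 0"
      by (simp add: c_def)
    show "c 0 \<in> [Field \<beta>]\<^bsup>n\<^esup>"
      using p \<open>0 < length p\<close> by (auto simp: c_def is_cycle_def type_graph_def)
    show "has_type \<beta> n (c i) (c (Suc i)) (std_type n s)
        \<or> has_type \<beta> n (c (Suc i)) (c i) (std_type n s)" if "i < length p" for i
      using p that by (intro type_graph_edge) (simp add: c_def is_cycle_def)
  qed (use len in auto)
qed

end
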